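(* Let $A\in\mathbb{R}^{n\times n}$ be symmetric positive definite and let $B\in\mathbb{R}^{m\times n}$ with $\operatorname{rank}(B)=m<n$. Let $Q=B\left(\tfrac12 A^{-1}-I\right)B^T$ and $\delta=\lambda_{\max}(Q)$, the largest eigenvalue of the symmetric matrix $Q$. Then for every $\alpha>\max\{\delta,0\}$ it holds that $\rho(\Gamma_{REHSS})<1$, where $\Gamma_{REHSS}$ is the iteration matrix $$\Gamma_{REHSS}=\begin{bmatrix}A & AB^T\\ -B & \alpha I\end{bmatrix}^{-1}\begin{bmatrix}0 & (A-I)B^T\\ 0 & \alpha I\end{bmatrix}.$$
   Context: For a square matrix $X$, $\rho(X)$ denotes its spectral radius. The saddle point matrix is $\mathcal{A}=\begin{bmatrix}A & B^T\\ -B & 0\end{bmatrix}\in\mathbb{R}^{(n+m)\times(n+m)}$. For $\alpha>0$ the REHSS splitting is $\mathcal{A}=\mathcal{P}_{REHSS}-\mathcal{R}_{REHSS}$ with $\mathcal{P}_{REHSS}=\begin{bmatrix}A & AB^T\\ -B & \alpha I\end{bmatrix}$ and $\mathcal{R}_{REHSS}=\begin{bmatrix}0 & (A-I)B^T\\ 0 & \alpha I\end{bmatrix}$, and $\Gamma_{REHSS}=\mathcal{P}_{REHSS}^{-1}\mathcal{R}_{REHSS}$. Here $\mathcal{P}_{REHSS}$ is invertible for every $\alpha>0$. $I$ denotes the identity matrix of the appropriate size. *)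

theory Defs
  imports
    "Jordan_Normal_Form.Gauss_Jordan_Elimination"
    "Jordan_Normal_Form.DL_Rank"
    "Jordan_Normal_Form.Spectral_Radius"
begin

definition sym_pos_def :: "nat \<Rightarrow> real mat \<Rightarrow> bool" where
  "sym_pos_def n A \<longleftrightarrow> A \<in> carrier_mat n n \<and> transpose_mat A = A \<and>
     (\<forall>x \<in> carrier_vec n. x \<noteq> 0\<^sub>v n \<longrightarrow> x \<bullet> (A *\<^sub>v x) > 0)"

text \<open>The value is unspecified if the argument is singular.\<close>

definition mat_inv :: "'a :: field mat \<Rightarrow> 'a mat" where
  "mat_inv A = the (mat_inverse A)"

text \<open>The largest real eigenvalue; meant for real symmetric matrices of positive dimension,
  which have only real eigenvalues and at least one.\<close>

definition lambda_max :: "real mat \<Rightarrow> real" where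
  "lambda_max M = Max (spectrum M)"

text \<open>The spectral radius of a real matrix ranges over all of its complex eigenvalues.\<close>

definition real_spectral_radius :: "real mat \<Rightarrow> real" where
  "real_spectral_radius M = spectral_radius (map_mat complex_of_real M)"

definition P_REHSS :: "nat \<Rightarrow> real mat \<Rightarrow> real mat \<Rightarrow> real \<Rightarrow> real mat" where
  "P_REHSS m A B \<alpha> =
     four_block_mat A (A * transpose_mat B) (- B) (\<alpha> \<cdot>\<^sub>m 1\<^sub>m m)"

definition R_REHSS :: "nat \<Rightarrow> nat \<Rightarrow> real mat \<Rightarrow> real mat \<Rightarrow> real \<Rightarrow> real mat" where
  "R_REHSS n m A B \<alpha> =
     four_block_mat (0\<^sub>m n n) ((A - 1\<^sub>m n) * transpose_mat B) (0\<^sub>m m n) (\<alpha> \<cdot>\<^sub>m 1\<^sub>m m)"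

definition Gamma_REHSS :: "nat \<Rightarrow> nat \<Rightarrow> real mat \<Rightarrow> real mat \<Rightarrow> real \<Rightarrow> real mat" where
  "Gamma_REHSS n m A B \<alpha> = mat_inv (P_REHSS m A B \<alpha>) * R_REHSS n m A B \<alpha>"

definition Q_REHSS :: "nat \<Rightarrow> real mat \<Rightarrow> real mat \<Rightarrow> real mat" where
  "Q_REHSS n A B = B * ((1/2) \<cdot>\<^sub>m mat_inv A - 1\<^sub>m n) * transpose_mat B"

end

theory Submission
  imports Defs
begin

text \<open>
  Multiplying from the left by the unit block triangular matrix with lower left block
  $B A^{-1}$ clears the lower left block of the preconditioner. In its place the Schur complement
  $S = \alpha I + B B^T$ appears in the lower right corner, and the same elimination turns the lower
  right block of the remainder into $T = S - B A^{-1} B^T$. An eigenpair $(\lambda, (x, y))$ of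
  the iteration matrix with $\lambda \neq 0$ therefore has $y \neq 0$ (otherwise $A x = 0$)
  and satisfies
  \[ T y = \lambda S y. \]
  Both $S$ and $T$ are real symmetric and $S$ is positive definite because $\alpha > 0$, so $\lambda$ is real and
  equals the quotient $(y^* T y) / (y^* S y)$. This quotient lies strictly
  between $-1$ and $1$ for two reasons.

  It is below $1$ because $S - T = B A^{-1} B^T$ is positive definite: $A^{-1}$ is, and $B^T$ is
  injective since $B$ has full row rank.

  It is above $-1$ because $S + T = 2 (\alpha I - Q)$. Here $\alpha$ exceeds the largest eigenvalue
  of the symmetric matrix $Q$, hence also the Rayleigh quotient of $Q$ at every vector.

  The lemma \<open>symmetric_pencil_norm_less_1\<close> turns these two estimates into $|\lambda| < 1$;
  \<open>schur_R_dominated\<close> provides them, using \<open>rayleigh_le\<close> for the second one; and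
  \<open>Gamma_REHSS_eigenvalue_pencil\<close> carries out the elimination.
\<close>

section \<open>Matrices and vectors\<close>

text \<open>The inverse function is total and says nothing about singular arguments; over a field a
  trivial kernel makes the determinant nonzero, which is what the Gauss--Jordan algorithm
  needs to succeed.\<close>

lemma mat_inv_inverts:
  fixes A :: "'a :: field mat"
  assumes A: "A \<in> carrier_mat n n"
    and inj: "\<And>v. v \<in> carrier_vec n \<Longrightarrow> A *\<^sub>v v = 0\<^sub>v n \<Longrightarrow> v = 0\<^sub>v n"
  shows "mat_inv A \<in> carrier_mat n n" "A * mat_inv A = 1\<^sub>m n" "mat_inv A * A = 1\<^sub>m n"
proof -
  have "det A \<noteq> 0"
    using det_0_iff_vec_prod_zero_field[OF A] inj by blast
  from det_non_zero_imp_unit[OF A this, where b = "()"]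
  obtain M where M: "mat_inverse A = Some M"
    using mat_inverse(1)[OF A, where b = "()"] by (cases "mat_inverse A") auto
  show "mat_inv A \<in> carrier_mat n n" "A * mat_inv A = 1\<^sub>m n" "mat_inv A * A = 1\<^sub>m n"
    using mat_inverse(2)[OF A M] by (auto simp: mat_inv_def M)
qed

lemma smult_mat_mult_vec:
  fixes M :: "'a :: comm_ring_1 mat"
  assumes "M \<in> carrier_mat nr n" "v \<in> carrier_vec n"
  shows "(k \<cdot>\<^sub>m M) *\<^sub>v v = k \<cdot>\<^sub>v (M *\<^sub>v v)"
  using assms by (auto intro!: eq_vecI simp: scalar_prod_def sum_distrib_left ac_simps)

lemma mult_mat_zero_vec:
  "M \<in> carrier_mat nr n \<Longrightarrow> M *\<^sub>v 0\<^sub>v n = (0\<^sub>v nr :: 'a :: comm_ring_1 vec)"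
  by (auto intro!: eq_vecI)

lemma zero_mat_mult_vec:
  "v \<in> carrier_vec n \<Longrightarrow> 0\<^sub>m nr n *\<^sub>v v = (0\<^sub>v nr :: 'a :: comm_ring_1 vec)"
  by (auto intro!: eq_vecI)

lemma transpose_smult: "transpose_mat (k \<cdot>\<^sub>m M) = k \<cdot>\<^sub>m transpose_mat M"
  by (intro eq_matI) auto

lemma transpose_congruence:
  fixes M :: "'a :: comm_semiring_0 mat"
  assumes B: "B \<in> carrier_mat m n" and M: "M \<in> carrier_mat n n" "transpose_mat M = M"
  shows "transpose_mat (B * (M * transpose_mat B)) = B * (M * transpose_mat B)"
proof -
  have Bt: "transpose_mat B \<in> carrier_mat n m" using B by simp
  show ?thesis
    unfolding transpose_mult[OF B mult_carrier_mat[OF M(1) Bt]] transpose_mult[OF M(1) Bt] M(2)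
      transpose_transpose
    by (rule assoc_mult_mat[OF B M(1) Bt])
qed

lemma scalar_prod_self_nonneg: "x \<bullet> x \<ge> (0 :: real)"
  by (simp add: scalar_prod_def sum_nonneg)

lemma scalar_prod_self_pos:
  fixes x :: "real vec"
  assumes "x \<in> carrier_vec n" "x \<noteq> 0\<^sub>v n"
  shows "x \<bullet> x > 0"
  using conjugate_square_greater_0_vec[OF assms(1)] assms(2) by simp

lemma scalar_prod_symmetric_mat:
  fixes M :: "'a :: comm_semiring_0 mat"
  assumes "M \<in> carrier_mat n n" "transpose_mat M = M" "x \<in> carrier_vec n" "y \<in> carrier_vec n"
  shows "x \<bullet> (M *\<^sub>v y) = y \<bullet> (M *\<^sub>v x)"
  using transpose_vec_mult_scalar[OF assms(1) assms(4) assms(3)] assms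
    comm_scalar_prod[of "M *\<^sub>v x" n y] by simp

section \<open>Positive definite matrices\<close>

lemma sym_pos_def_kernel:
  assumes "sym_pos_def n A" "v \<in> carrier_vec n" "A *\<^sub>v v = 0\<^sub>v n"
  shows "v = 0\<^sub>v n"
proof (rule ccontr)
  assume "v \<noteq> 0\<^sub>v n"
  then have "v \<bullet> (A *\<^sub>v v) > 0" using assms(1,2) by (simp add: sym_pos_def_def)
  with assms(2,3) show False by simp
qed

text \<open>Positivity passes to the inverse by the substitution $w = A v$, under which
  $w^T A^{-1} w = v^T A v$.\<close>

lemma sym_pos_def_mat_inv:
  assumes A: "sym_pos_def n A"
  shows "A * mat_inv A = 1\<^sub>m n" "mat_inv A * A = 1\<^sub>m n" "sym_pos_def n (mat_inv A)"
proof -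
  have Ac: "A \<in> carrier_mat n n" and A_sym: "transpose_mat A = A"
    using A by (auto simp: sym_pos_def_def)
  show r: "A * mat_inv A = 1\<^sub>m n" and l: "mat_inv A * A = 1\<^sub>m n"
    by (rule mat_inv_inverts[OF Ac sym_pos_def_kernel[OF A]]; assumption)+
  have Ai: "mat_inv A \<in> carrier_mat n n"
    by (rule mat_inv_inverts[OF Ac sym_pos_def_kernel[OF A]])
  have "transpose_mat (mat_inv A) = transpose_mat (mat_inv A) * (A * mat_inv A)"
    using Ai by (simp add: r)
  also have "\<dots> = transpose_mat (A * mat_inv A) * mat_inv A"
    using Ai Ac assoc_mult_mat[of "transpose_mat (mat_inv A)" n n A n "mat_inv A" n]
    by (simp add: A_sym transpose_mult[OF Ac Ai])
  also have "\<dots> = mat_inv A" using Ai by (simp add: r)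
  finally have Ai_sym: "transpose_mat (mat_inv A) = mat_inv A" .
  have "w \<bullet> (mat_inv A *\<^sub>v w) > 0" if w: "w \<in> carrier_vec n" "w \<noteq> 0\<^sub>v n" for w
  proof -
    define v where "v = mat_inv A *\<^sub>v w"
    have v: "v \<in> carrier_vec n" and Av: "A *\<^sub>v v = w"
      using w Ai assoc_mult_mat_vec[OF Ac Ai w(1)] by (simp_all add: v_def r)
    then have "v \<noteq> 0\<^sub>v n" using w(2) mult_mat_zero_vec[OF Ac] by auto
    then have "v \<bullet> (A *\<^sub>v v) > 0" using A v by (simp add: sym_pos_def_def)
    then show ?thesis
      using comm_scalar_prod[OF v w(1)] by (simp add: Av flip: v_def)
  qed
  then show "sym_pos_def n (mat_inv A)"
    using Ai Ai_sym by (auto simp: sym_pos_def_def)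
qed

section \<open>The Rayleigh quotient of a symmetric matrix\<close>

text \<open>A crude bound suffices: it shows that the Rayleigh quotient has a finite supremum and that
  the quadratic form of an inverse is controlled by the norm.\<close>

lemma quadratic_form_bounded:
  fixes M :: "real mat"
  assumes M: "M \<in> carrier_mat n n"
  obtains c where "c > 0" "\<And>x. x \<in> carrier_vec n \<Longrightarrow> \<bar>x \<bullet> (M *\<^sub>v x)\<bar> \<le> c * (x \<bullet> x)"
proof
  let ?c = "(\<Sum>i<n. \<Sum>j<n. \<bar>M $$ (i,j)\<bar>) + 1"
  show "?c > 0"
    by (simp add: add_nonneg_pos sum_nonneg)
  fix x :: "real vec" assume x: "x \<in> carrier_vec n"
  have coord: "(x $ i)\<^sup>2 \<le> x \<bullet> x" if "i < n" for i
    using member_le_sum[of i "{0..<n}" "\<lambda>i. (x $ i)\<^sup>2"] that x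
    by (simp add: scalar_prod_def power2_eq_square)
  have pair: "\<bar>x $ i * x $ j\<bar> \<le> x \<bullet> x" if "i < n" "j < n" for i j
  proof -
    have "2 * \<bar>x $ i * x $ j\<bar> \<le> (x $ i)\<^sup>2 + (x $ j)\<^sup>2"
      using sum_squares_bound[of "\<bar>x $ i\<bar>" "\<bar>x $ j\<bar>"] by (simp add: abs_mult)
    then show ?thesis using coord[OF that(1)] coord[OF that(2)] by linarith
  qed
  have "x \<bullet> (M *\<^sub>v x) = (\<Sum>i<n. \<Sum>j<n. M $$ (i,j) * (x $ i * x $ j))"
    using M x by (auto simp: scalar_prod_def sum_distrib_left lessThan_atLeast0 ac_simps
        intro!: sum.cong)
  also have "\<bar>\<dots>\<bar> \<le> (\<Sum>i<n. \<Sum>j<n. \<bar>M $$ (i,j)\<bar> * (x \<bullet> x))"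
    by (intro order_trans[OF sum_abs] sum_mono)
       (auto simp: abs_mult[of "M $$ _"] intro!: mult_left_mono pair)
  also have "\<dots> \<le> ?c * (x \<bullet> x)"
    using scalar_prod_self_nonneg[of x] by (simp add: sum_distrib_right distrib_right)
  finally show "\<bar>x \<bullet> (M *\<^sub>v x)\<bar> \<le> ?c * (x \<bullet> x)" .
qed

text \<open>The supremum $t$ of the Rayleigh quotient is itself an eigenvalue, and this can be seen
  without diagonalising or compactness. The matrix $C = t I - Q$ is positive semidefinite. If it
  were invertible, then expanding $w^T C w \geq 0$ at $w = y - b^{-1} C^{-1} y$, where $b$ bounds
  the quadratic form of $C^{-1}$, would give $y^T C y \geq b^{-1} y^T y$ for every $y$. The
  Rayleigh quotient would then never exceed $t - b^{-1}$, against the choice of $t$.\<close>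

lemma rayleigh_le:
  fixes Q :: "real mat"
  assumes Q: "Q \<in> carrier_mat n n" and sym: "transpose_mat Q = Q"
    and ev: "\<And>k. eigenvalue Q k \<Longrightarrow> k \<le> d"
    and x: "x \<in> carrier_vec n"
  shows "x \<bullet> (Q *\<^sub>v x) \<le> d * (x \<bullet> x)"
proof (cases "x = 0\<^sub>v n")
  case True
  then show ?thesis using Q by simp
next
  case False
  define r where "r y = (y \<bullet> (Q *\<^sub>v y)) / (y \<bullet> y)" for y
  define S where "S = r ` (carrier_vec n - {0\<^sub>v n})"
  define t where "t = Sup S"
  obtain c where c: "c > 0" "\<And>y. y \<in> carrier_vec n \<Longrightarrow> \<bar>y \<bullet> (Q *\<^sub>v y)\<bar> \<le> c * (y \<bullet> y)"
    using quadratic_form_bounded[OF Q] by blast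
  have "r y \<le> c" if "y \<in> carrier_vec n" "y \<noteq> 0\<^sub>v n" for y
    using c(2)[OF that(1)] scalar_prod_self_pos[OF that] by (simp add: r_def divide_le_eq)
  then have bdd: "bdd_above S" unfolding S_def by (intro bdd_aboveI2) auto
  have rS: "r y \<in> S" if "y \<in> carrier_vec n" "y \<noteq> 0\<^sub>v n" for y
    using that by (auto simp: S_def)
  have rt: "r y \<le> t" if "y \<in> carrier_vec n" "y \<noteq> 0\<^sub>v n" for y
    unfolding t_def using cSup_upper[OF rS[OF that] bdd] .
  have le_t: "y \<bullet> (Q *\<^sub>v y) \<le> t * (y \<bullet> y)" if y: "y \<in> carrier_vec n" for y
  proof (cases "y = 0\<^sub>v n")
    case True then show ?thesis using Q by simp
  next
    case nz: False
    then show ?thesis using rt[OF y nz] scalar_prod_self_pos[OF y nz]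
      by (simp add: r_def divide_le_eq)
  qed
  have "eigenvalue Q t"
  proof (rule ccontr)
    assume not_ev: "\<not> eigenvalue Q t"
    define C where "C = t \<cdot>\<^sub>m 1\<^sub>m n - Q"
    have C: "C \<in> carrier_mat n n" unfolding C_def by (rule minus_carrier_mat[OF Q])
    have C_sym: "transpose_mat C = C"
      using Q sym by (intro eq_matI) (auto simp: C_def, metis carrier_matD index_transpose_mat(1))
    have Cv: "C *\<^sub>v v = t \<cdot>\<^sub>v v - Q *\<^sub>v v" if "v \<in> carrier_vec n" for v
      using Q that by (simp add: C_def minus_mult_distrib_mat_vec[of _ n n] smult_mat_mult_vec[of _ n n])
    have vCv: "v \<bullet> (C *\<^sub>v v) = t * (v \<bullet> v) - v \<bullet> (Q *\<^sub>v v)" if "v \<in> carrier_vec n" for v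
      using Q that by (simp add: Cv scalar_prod_minus_distrib[of _ n])
    have inj: "v = 0\<^sub>v n" if v: "v \<in> carrier_vec n" and 0: "C *\<^sub>v v = 0\<^sub>v n" for v
    proof (rule ccontr)
      assume "v \<noteq> 0\<^sub>v n"
      moreover have "Q *\<^sub>v v = t \<cdot>\<^sub>v v"
      proof (intro eq_vecI)
        fix i assume "i < dim_vec (t \<cdot>\<^sub>v v)"
        then show "(Q *\<^sub>v v) $ i = (t \<cdot>\<^sub>v v) $ i"
          using arg_cong[OF 0, of "\<lambda>w. w $ i"] v Q by (simp add: Cv del: index_mult_mat_vec)
      qed (use Q v in auto)
      ultimately show False using not_ev v Q
        by (auto simp: eigenvalue_def eigenvector_def)
    qed
    note Ci = mat_inv_inverts[OF C inj]
    obtain b where b: "b > 0"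
      "\<And>y. y \<in> carrier_vec n \<Longrightarrow> \<bar>y \<bullet> (mat_inv C *\<^sub>v y)\<bar> \<le> b * (y \<bullet> y)"
      using quadratic_form_bounded[OF Ci(1)] by blast
    have "s \<le> t - 1 / b" if "s \<in> S" for s
    proof -
      from that obtain y where y: "y \<in> carrier_vec n" "y \<noteq> 0\<^sub>v n" and s: "s = r y"
        by (auto simp: S_def)
      define z where "z = mat_inv C *\<^sub>v y"
      have z: "z \<in> carrier_vec n" and Cz: "C *\<^sub>v z = y"
        using y Ci assoc_mult_mat_vec[OF C Ci(1) y(1)] by (simp_all add: z_def)
      \<comment> \<open>The coefficient minimises the bound
        $y^T C y - 2 c y^T y + c^2 b y^T y$ over $c$.\<close>
      define w where "w = y - (1 / b) \<cdot>\<^sub>v z"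
      have w: "w \<in> carrier_vec n" using y z by (simp add: w_def)
      have zCy: "z \<bullet> (C *\<^sub>v y) = y \<bullet> y"
        using scalar_prod_symmetric_mat[OF C C_sym z y(1)] Cz by simp
      have "0 \<le> w \<bullet> (C *\<^sub>v w)"
        using le_t[OF w] by (simp add: vCv[OF w])
      also have "C *\<^sub>v w = C *\<^sub>v y - (1 / b) \<cdot>\<^sub>v y"
        using C y z by (simp add: w_def mult_minus_distrib_mat_vec[of _ n n] mult_mat_vec[of _ n n] Cz)
      also have "w \<bullet> \<dots> = y \<bullet> (C *\<^sub>v y) - 2 / b * (y \<bullet> y) + (1 / b)\<^sup>2 * (y \<bullet> z)"
        using C y z zCy comm_scalar_prod[OF z y(1)]
        by (simp add: w_def scalar_prod_minus_distrib[of _ n] minus_scalar_prod_distrib[of _ n]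
            power2_eq_square algebra_simps)
      also have "\<dots> \<le> y \<bullet> (C *\<^sub>v y) - 2 / b * (y \<bullet> y) + (1 / b)\<^sup>2 * (b * (y \<bullet> y))"
        using b(2)[OF y(1)] by (intro add_left_mono mult_left_mono) (auto simp: z_def)
      also have "\<dots> = y \<bullet> (C *\<^sub>v y) - (y \<bullet> y) / b"
        using b(1) by (simp add: power2_eq_square)
      finally have "y \<bullet> (Q *\<^sub>v y) \<le> (t - 1 / b) * (y \<bullet> y)"
        by (simp add: vCv[OF y(1)] algebra_simps)
      then show ?thesis
        using scalar_prod_self_pos[OF y] by (simp add: s r_def divide_le_eq)
    qed
    then have "t \<le> t - 1 / b"
      unfolding t_def by (intro cSup_least) (use x False in \<open>auto simp: S_def\<close>)
    then show False using b(1) by simp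
  qed
  from ev[OF this] have "t * (x \<bullet> x) \<le> d * (x \<bullet> x)"
    by (intro mult_right_mono scalar_prod_self_nonneg)
  then show ?thesis using le_t[OF x] by linarith
qed

section \<open>Full row rank\<close>

text \<open>The columns span the whole space, so any $x$ is of the form $B w$; if $B^T x = 0$ then
  $x^T x = (B^T x)^T w = 0$.\<close>

lemma transpose_inj_of_full_row_rank:
  fixes B :: "real mat"
  assumes B: "B \<in> carrier_mat m n" and rank: "vec_space.rank m B = m"
    and x: "x \<in> carrier_vec m" and Bx: "transpose_mat B *\<^sub>v x = 0\<^sub>v n"
  shows "x = 0\<^sub>v m"
proof -
  interpret vec_space "TYPE(real)" m .
  have cols: "set (cols B) \<subseteq> carrier V"
    using cols_dim[of B] B by auto
  have "lin_indpt {}"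
    by (simp add: lin_dep_def)
  with maximal_exists_superset[of "set (cols B)" "\<lambda>T. T \<subseteq> set (cols B) \<and> lin_indpt T" "{}"]
  obtain S where S: "finite S" "maximal S (\<lambda>T. T \<subseteq> set (cols B) \<and> lin_indpt T)"
    by auto
  have S': "S \<subseteq> set (cols B)" "lin_indpt S" using S(2) by (auto simp: maximal_def)
  have "card S = m" using rank_card_indpt[OF B S(2)] rank by simp
  then have "basis S"
    using S(1) S' cols by (intro dim_li_is_basis) (auto simp: dim_is_n)
  then have "carrier V = span S" by (simp add: basis_def)
  also have "\<dots> \<subseteq> col_space B"
    unfolding col_space_def by (intro span_is_monotone S')
  finally obtain w where w: "w \<in> carrier_vec n" "B *\<^sub>v w = x"
    using x B by (auto simp: col_space_eq[OF B])
  have "x \<bullet> x = (transpose_mat B *\<^sub>v x) \<bullet> w"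
    using transpose_vec_mult_scalar[OF B w(1) x] w(2) by simp
  then have "x \<bullet> x = 0" using Bx w(1) by simp
  then show ?thesis using scalar_prod_self_pos[OF x] by fastforce
qed

section \<open>Symmetric definite pencils\<close>

abbreviation cmat :: "real mat \<Rightarrow> complex mat" where
  "cmat \<equiv> map_mat complex_of_real"

lemma cmat_mult:
  assumes "A \<in> carrier_mat nr n" "B \<in> carrier_mat n nc"
  shows "cmat (A * B) = cmat A * cmat B"
  using of_real_hom.mat_hom_mult[OF assms] .

lemma Re_Im_mult_mat_vec:
  assumes "M \<in> carrier_mat nr n" "y \<in> carrier_vec n"
  shows "map_vec Re (cmat M *\<^sub>v y) = M *\<^sub>v map_vec Re y"
    "map_vec Im (cmat M *\<^sub>v y) = M *\<^sub>v map_vec Im y"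
  using assms by (auto intro!: eq_vecI simp: scalar_prod_def)

text \<open>Splitting $y = u + i v$ and $\lambda = s + i t$ gives two real equations,
  $K u = s G u - t G v$ and $K v = s G v + t G u$. Symmetry makes $u^T K v - v^T K u$ vanish, which
  forces $t (u^T G u + v^T G v) = 0$ and hence $t = 0$; adding $u^T K u$ and $v^T K v$ then yields
  $s$ as the quotient of the two quadratic forms.\<close>

lemma symmetric_pencil_norm_less_1:
  fixes K G :: "real mat" and l :: complex
  assumes K: "K \<in> carrier_mat n n" "transpose_mat K = K"
    and G_pd: "sym_pos_def n G"
    and dom: "\<And>x. x \<in> carrier_vec n \<Longrightarrow> x \<noteq> 0\<^sub>v n \<Longrightarrow> \<bar>x \<bullet> (K *\<^sub>v x)\<bar> < x \<bullet> (G *\<^sub>v x)"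
    and y: "y \<in> carrier_vec n" "y \<noteq> 0\<^sub>v n"
    and eq: "cmat K *\<^sub>v y = l \<cdot>\<^sub>v (cmat G *\<^sub>v y)"
  shows "cmod l < 1"
proof -
  have G: "G \<in> carrier_mat n n" "transpose_mat G = G"
    using G_pd by (auto simp: sym_pos_def_def)
  define u v where "u = map_vec Re y" and "v = map_vec Im y"
  define s t where "s = Re l" and "t = Im l"
  have u: "u \<in> carrier_vec n" and v: "v \<in> carrier_vec n"
    using y by (auto simp: u_def v_def)
  have Gy: "Re ((cmat G *\<^sub>v y) $ i) = (G *\<^sub>v u) $ i" "Im ((cmat G *\<^sub>v y) $ i) = (G *\<^sub>v v) $ i"
    if "i < n" for i
    using that G(1) Re_Im_mult_mat_vec[OF G(1) y(1), THEN arg_cong, of "\<lambda>w. w $ i"]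
    by (simp_all add: u_def v_def del: index_mult_mat_vec)
  have Ku: "K *\<^sub>v u = s \<cdot>\<^sub>v (G *\<^sub>v u) - t \<cdot>\<^sub>v (G *\<^sub>v v)"
    unfolding u_def Re_Im_mult_mat_vec(1)[OF K(1) y(1), symmetric] eq
    using G(1) by (intro eq_vecI) (simp_all add: Gy s_def t_def u_def v_def del: index_mult_mat_vec)
  have Kv: "K *\<^sub>v v = s \<cdot>\<^sub>v (G *\<^sub>v v) + t \<cdot>\<^sub>v (G *\<^sub>v u)"
    unfolding v_def Re_Im_mult_mat_vec(2)[OF K(1) y(1), symmetric] eq
    using G(1) by (intro eq_vecI) (simp_all add: Gy s_def t_def u_def v_def del: index_mult_mat_vec)
  define g k where "g = u \<bullet> (G *\<^sub>v u) + v \<bullet> (G *\<^sub>v v)" and "k = u \<bullet> (K *\<^sub>v u) + v \<bullet> (K *\<^sub>v v)"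
  have "u \<noteq> 0\<^sub>v n \<or> v \<noteq> 0\<^sub>v n"
  proof (rule ccontr)
    assume "\<not> ?thesis"
    then have 0: "u = 0\<^sub>v n" "v = 0\<^sub>v n" by auto
    have "y = 0\<^sub>v n"
    proof (intro eq_vecI)
      fix i assume "i < dim_vec (0\<^sub>v n :: complex vec)"
      then show "y $ i = 0\<^sub>v n $ i"
        using y(1) 0[THEN arg_cong, of "\<lambda>w. w $ i"] by (simp add: u_def v_def complex_eq_iff)
    qed (use y in auto)
    with y(2) show False by simp
  qed
  moreover have "\<bar>x \<bullet> (K *\<^sub>v x)\<bar> \<le> x \<bullet> (G *\<^sub>v x)" if "x \<in> carrier_vec n" for x
    using dom[OF that] K(1) G(1) by (cases "x = 0\<^sub>v n") auto
  ultimately have gk: "\<bar>k\<bar> < g"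
    unfolding g_def k_def using dom[OF u] dom[OF v] u v
    by (smt (verit, best))
  have uGv: "u \<bullet> (G *\<^sub>v v) = v \<bullet> (G *\<^sub>v u)" and uKv: "u \<bullet> (K *\<^sub>v v) = v \<bullet> (K *\<^sub>v u)"
    using scalar_prod_symmetric_mat[OF G u v] scalar_prod_symmetric_mat[OF K u v] by auto
  have 1: "k = s * g"
    using u v G(1) uGv by (simp add: k_def g_def Ku Kv scalar_prod_minus_distrib[of _ n]
        scalar_prod_add_distrib[of _ n] algebra_simps)
  have "t * g = 0"
    using uKv u v G(1) uGv by (simp add: g_def Ku Kv scalar_prod_minus_distrib[of _ n]
        scalar_prod_add_distrib[of _ n] algebra_simps)
  then have "t = 0" using gk by auto
  then have "cmod l = \<bar>s\<bar>" by (simp add: cmod_def s_def t_def)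
  moreover have "\<bar>s\<bar> * g < 1 * g"
    using gk abs_mult_pos[of g s] by (simp add: 1)
  then have "\<bar>s\<bar> < 1"
    by (rule mult_right_less_imp_less) (use gk in linarith)
  ultimately show ?thesis by simp
qed

lemma cmat_four_block:
  assumes "A \<in> carrier_mat n n" "B \<in> carrier_mat n m" "C \<in> carrier_mat m n" "D \<in> carrier_mat m m"
  shows "cmat (four_block_mat A B C D) = four_block_mat (cmat A) (cmat B) (cmat C) (cmat D)"
  using assms by (intro eq_matI) auto

section \<open>Block elimination for the REHSS splitting\<close>

text \<open>The Schur complement of $A$ in the preconditioner: the product $B A^{-1} (A B^T)$ in its
  formula collapses to $B B^T$.\<close>

definition schur_P :: "nat \<Rightarrow> real mat \<Rightarrow> real \<Rightarrow> real mat" where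
  "schur_P m B \<alpha> = \<alpha> \<cdot>\<^sub>m 1\<^sub>m m + B * transpose_mat B"

text \<open>The lower right block of the remainder after the same elimination, that is
  $\alpha I + B A^{-1} (A - I) B^T$.\<close>

definition schur_R :: "nat \<Rightarrow> real mat \<Rightarrow> real mat \<Rightarrow> real \<Rightarrow> real mat" where
  "schur_R m A B \<alpha> = schur_P m B \<alpha> - B * (mat_inv A * transpose_mat B)"

definition eliminator :: "nat \<Rightarrow> nat \<Rightarrow> real mat \<Rightarrow> real mat \<Rightarrow> real mat" where
  "eliminator n m A B = four_block_mat (1\<^sub>m n) (0\<^sub>m n m) (B * mat_inv A) (1\<^sub>m m)"

context
  fixes n m :: nat and A B :: "real mat" and \<alpha> :: real
  assumes A: "sym_pos_def n A" and B: "B \<in> carrier_mat m n" and \<alpha>: "\<alpha> > 0"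
begin

lemma A_carrier: "A \<in> carrier_mat n n"
  using A by (simp add: sym_pos_def_def)

lemmas Ai = sym_pos_def_mat_inv[OF A]

lemma Ai_carrier: "mat_inv A \<in> carrier_mat n n"
  using Ai(3) by (simp add: sym_pos_def_def)

lemma block_carriers:
  "schur_P m B \<alpha> \<in> carrier_mat m m" "schur_R m A B \<alpha> \<in> carrier_mat m m"
  "eliminator n m A B \<in> carrier_mat (n + m) (n + m)"
  "P_REHSS m A B \<alpha> \<in> carrier_mat (n + m) (n + m)"
  "R_REHSS n m A B \<alpha> \<in> carrier_mat (n + m) (n + m)"
  using A_carrier Ai_carrier B
  unfolding schur_P_def schur_R_def eliminator_def P_REHSS_def R_REHSS_def
  by (auto intro!: four_block_carrier_mat)

lemma form_transpose:
  assumes "x \<in> carrier_vec m" "w \<in> carrier_vec n"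
  shows "x \<bullet> (B *\<^sub>v w) = (transpose_mat B *\<^sub>v x) \<bullet> w"
  using transpose_vec_mult_scalar[OF B assms(2,1)] by simp

lemma schur_P_form:
  assumes x: "x \<in> carrier_vec m"
  shows "x \<bullet> (schur_P m B \<alpha> *\<^sub>v x)
    = \<alpha> * (x \<bullet> x) + (transpose_mat B *\<^sub>v x) \<bullet> (transpose_mat B *\<^sub>v x)"
proof -
  have w: "transpose_mat B *\<^sub>v x \<in> carrier_vec n" using B x by simp
  show ?thesis
    using B x w
    by (simp add: schur_P_def smult_mat_mult_vec[of _ m m] add_mult_distrib_mat_vec[of _ m m]
        assoc_mult_mat_vec[of _ m n _ m] scalar_prod_add_distrib[of _ m] form_transpose)
qed

lemma schur_R_form:
  assumes x: "x \<in> carrier_vec m"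
  shows "x \<bullet> (schur_R m A B \<alpha> *\<^sub>v x) = x \<bullet> (schur_P m B \<alpha> *\<^sub>v x)
    - (transpose_mat B *\<^sub>v x) \<bullet> (mat_inv A *\<^sub>v (transpose_mat B *\<^sub>v x))"
proof -
  have w: "transpose_mat B *\<^sub>v x \<in> carrier_vec n" using B x by simp
  show ?thesis
    using B x w Ai_carrier block_carriers(1)
    by (simp add: schur_R_def minus_mult_distrib_mat_vec[of _ m m] assoc_mult_mat_vec[of _ m n _ m]
        assoc_mult_mat_vec[of _ n n _ m] scalar_prod_minus_distrib[of _ m] form_transpose)
qed

lemma Q_REHSS_form:
  assumes x: "x \<in> carrier_vec m"
  shows "x \<bullet> (Q_REHSS n A B *\<^sub>v x)
    = (transpose_mat B *\<^sub>v x) \<bullet> (mat_inv A *\<^sub>v (transpose_mat B *\<^sub>v x)) / 2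
      - (transpose_mat B *\<^sub>v x) \<bullet> (transpose_mat B *\<^sub>v x)"
proof -
  define w where "w = transpose_mat B *\<^sub>v x"
  define N where "N = (1/2) \<cdot>\<^sub>m mat_inv A - 1\<^sub>m n"
  have w: "w \<in> carrier_vec n" using B x by (simp add: w_def)
  have N: "N \<in> carrier_mat n n" unfolding N_def by (intro minus_carrier_mat one_carrier_mat)
  have "Q_REHSS n A B *\<^sub>v x = B *\<^sub>v (N *\<^sub>v w)"
    unfolding Q_REHSS_def N_def[symmetric] w_def using B N x
    by (simp add: assoc_mult_mat_vec[of _ m n _ m] assoc_mult_mat_vec[of _ n n _ m])
  then have "x \<bullet> (Q_REHSS n A B *\<^sub>v x) = w \<bullet> (N *\<^sub>v w)"
    using N w x by (simp add: form_transpose w_def)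
  also have "N *\<^sub>v w = (1/2) \<cdot>\<^sub>v (mat_inv A *\<^sub>v w) - w"
    using Ai_carrier w
    by (simp add: N_def minus_mult_distrib_mat_vec[of _ n n] smult_mat_mult_vec[of _ n n])
  also have "w \<bullet> \<dots> = w \<bullet> (mat_inv A *\<^sub>v w) / 2 - w \<bullet> w"
    using Ai_carrier w by (simp add: scalar_prod_minus_distrib[of _ n])
  finally show ?thesis by (simp add: w_def)
qed

lemma sym_pos_def_schur_P: "sym_pos_def m (schur_P m B \<alpha>)"
  unfolding sym_pos_def_def
proof (intro conjI ballI impI)
  show "schur_P m B \<alpha> \<in> carrier_mat m m" by (rule block_carriers)
  show "transpose_mat (schur_P m B \<alpha>) = schur_P m B \<alpha>"
    using B by (simp add: schur_P_def transpose_add[of _ m m] transpose_mult[of _ m n] transpose_smult)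
  fix x :: "real vec" assume x: "x \<in> carrier_vec m" "x \<noteq> 0\<^sub>v m"
  then show "x \<bullet> (schur_P m B \<alpha> *\<^sub>v x) > 0"
    using \<alpha> scalar_prod_self_pos[OF x] scalar_prod_self_nonneg
    by (simp add: schur_P_form add_pos_nonneg)
qed

lemma transpose_schur_R: "transpose_mat (schur_R m A B \<alpha>) = schur_R m A B \<alpha>"
proof -
  have "transpose_mat (B * (mat_inv A * transpose_mat B)) = B * (mat_inv A * transpose_mat B)"
    using Ai(3) by (intro transpose_congruence[OF B Ai_carrier]) (simp add: sym_pos_def_def)
  then show ?thesis
    unfolding schur_R_def using sym_pos_def_schur_P Ai_carrier B
    by (simp add: transpose_minus[of _ m m] sym_pos_def_def)
qed

lemma symmetric_Q_REHSS:
  "Q_REHSS n A B \<in> carrier_mat m m" "transpose_mat (Q_REHSS n A B) = Q_REHSS n A B"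
proof -
  define N where "N = (1/2) \<cdot>\<^sub>m mat_inv A - 1\<^sub>m n"
  have N: "N \<in> carrier_mat n n" unfolding N_def by (intro minus_carrier_mat one_carrier_mat)
  have N_sym: "transpose_mat N = N"
    using Ai_carrier Ai(3)
    by (simp add: N_def transpose_minus[of _ n n] transpose_smult sym_pos_def_def)
  have Q: "Q_REHSS n A B = B * (N * transpose_mat B)"
    unfolding Q_REHSS_def N_def[symmetric] using B N by (intro assoc_mult_mat) auto
  show "Q_REHSS n A B \<in> carrier_mat m m"
    unfolding Q using B N by (intro mult_carrier_mat[of _ m n] mult_carrier_mat[of _ n n]) auto
  show "transpose_mat (Q_REHSS n A B) = Q_REHSS n A B"
    unfolding Q by (rule transpose_congruence[OF B N N_sym])
qed

lemma eliminator_times_P: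
  "eliminator n m A B * P_REHSS m A B \<alpha>
    = four_block_mat A (A * transpose_mat B) (0\<^sub>m m n) (schur_P m B \<alpha>)"
proof -
  have BA: "B * mat_inv A * A = B"
    using A_carrier Ai_carrier Ai(2) B by (simp add: assoc_mult_mat[of _ m n _ n _ n])
  then have BAB: "B * mat_inv A * (A * transpose_mat B) = B * transpose_mat B"
    using assoc_mult_mat[of "B * mat_inv A" m n A n "transpose_mat B" m] A_carrier Ai_carrier B
    by simp
  show ?thesis
    unfolding eliminator_def P_REHSS_def schur_P_def using A_carrier B Ai_carrier
    by (subst mult_four_block_mat[of _ n n _ m _ m _ _ n _ m])
       (auto simp: BA BAB add_uminus_minus_mat[of _ m n] comm_add_mat[of _ m m])
qed

lemma eliminator_times_R:
  "eliminator n m A B * R_REHSS n m A B \<alpha>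
    = four_block_mat (0\<^sub>m n n) ((A - 1\<^sub>m n) * transpose_mat B) (0\<^sub>m m n) (schur_R m A B \<alpha>)"
proof -
  note c = A_carrier Ai_carrier B
  have BA: "B * mat_inv A * A = B"
    using c Ai(2) by (simp add: assoc_mult_mat[of _ m n _ n _ n])
  have "B * mat_inv A * ((A - 1\<^sub>m n) * transpose_mat B)
      = (B * mat_inv A * A - B * mat_inv A) * transpose_mat B"
    using assoc_mult_mat[of "B * mat_inv A" m n "A - 1\<^sub>m n" n "transpose_mat B" m] c
    by (simp add: mult_minus_distrib_mat[of _ m n] BA minus_carrier_mat del: assoc_mult_mat)
  also have "\<dots> = B * transpose_mat B - B * (mat_inv A * transpose_mat B)"
    unfolding BA using c
    by (simp add: minus_mult_distrib_mat[of _ m n] assoc_mult_mat[of _ m n _ n _ m])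
  finally have BAB: "B * mat_inv A * ((A - 1\<^sub>m n) * transpose_mat B)
      = B * transpose_mat B - B * (mat_inv A * transpose_mat B)" .
  have R: "B * transpose_mat B - B * (mat_inv A * transpose_mat B) + \<alpha> \<cdot>\<^sub>m 1\<^sub>m m = schur_R m A B \<alpha>"
    using c by (intro eq_matI) (auto simp: schur_R_def schur_P_def)
  have N: "(A - 1\<^sub>m n) * transpose_mat B \<in> carrier_mat n m"
    using B by (intro mult_carrier_mat[of _ n n] minus_carrier_mat) auto
  show ?thesis
    unfolding eliminator_def R_REHSS_def using c N
    by (subst mult_four_block_mat[of _ n n _ m _ m _ _ n _ m]) (simp_all add: BAB R)
qed

text \<open>After elimination the preconditioner is block triangular with positive definite
  diagonal blocks, so its kernel is trivial.\<close>

lemma P_REHSS_inverse: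
  shows "mat_inv (P_REHSS m A B \<alpha>) \<in> carrier_mat (n + m) (n + m)"
    "P_REHSS m A B \<alpha> * mat_inv (P_REHSS m A B \<alpha>) = 1\<^sub>m (n + m)"
proof -
  note c = block_carriers
  have inj: "z = 0\<^sub>v (n + m)"
    if z: "z \<in> carrier_vec (n + m)" and Pz: "P_REHSS m A B \<alpha> *\<^sub>v z = 0\<^sub>v (n + m)" for z
  proof -
    define x y where "x = vec_first z n" and "y = vec_last z m"
    have z_eq: "z = x @\<^sub>v y" and x: "x \<in> carrier_vec n" and y: "y \<in> carrier_vec m"
      using z by (simp_all add: x_def y_def)
    have "(eliminator n m A B * P_REHSS m A B \<alpha>) *\<^sub>v z = 0\<^sub>v (n + m)"
      using assoc_mult_mat_vec[OF c(3) c(4) z] mult_mat_zero_vec[OF c(3)] by (simp add: Pz)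
    then have "(A *\<^sub>v x + A * transpose_mat B *\<^sub>v y) @\<^sub>v (0\<^sub>m m n *\<^sub>v x + schur_P m B \<alpha> *\<^sub>v y)
        = 0\<^sub>v n @\<^sub>v 0\<^sub>v m"
      unfolding eliminator_times_P z_eq using A_carrier B x y c
      by (subst (asm) four_block_mat_mult_vec[of _ n n _ m _ m]) auto
    then have top: "A *\<^sub>v x + A * transpose_mat B *\<^sub>v y = 0\<^sub>v n"
      and bot: "schur_P m B \<alpha> *\<^sub>v y = 0\<^sub>v m"
      using A_carrier B x y c(1) by (auto simp: append_vec_eq[of _ n] zero_mat_mult_vec)
    have y0: "y = 0\<^sub>v m" by (rule sym_pos_def_kernel[OF sym_pos_def_schur_P y bot])
    then have "A *\<^sub>v x = 0\<^sub>v n"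
      using top A_carrier B x by (simp add: mult_mat_zero_vec[of _ n m])
    then have "x = 0\<^sub>v n" by (rule sym_pos_def_kernel[OF A x])
    then show ?thesis unfolding z_eq y0 by (intro eq_vecI) auto
  qed
  show "mat_inv (P_REHSS m A B \<alpha>) \<in> carrier_mat (n + m) (n + m)"
    by (rule mat_inv_inverts(1)[OF c(4)]) (rule inj)
  show "P_REHSS m A B \<alpha> * mat_inv (P_REHSS m A B \<alpha>) = 1\<^sub>m (n + m)"
    by (rule mat_inv_inverts(2)[OF c(4)]) (rule inj)
qed

lemma Gamma_REHSS:
  "Gamma_REHSS n m A B \<alpha> \<in> carrier_mat (n + m) (n + m)"
  "P_REHSS m A B \<alpha> * Gamma_REHSS n m A B \<alpha> = R_REHSS n m A B \<alpha>"
proof -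
  note c = block_carriers
  show "Gamma_REHSS n m A B \<alpha> \<in> carrier_mat (n + m) (n + m)"
    unfolding Gamma_REHSS_def by (rule mult_carrier_mat[OF P_REHSS_inverse(1) c(5)])
  show "P_REHSS m A B \<alpha> * Gamma_REHSS n m A B \<alpha> = R_REHSS n m A B \<alpha>"
    unfolding Gamma_REHSS_def assoc_mult_mat[OF c(4) P_REHSS_inverse(1) c(5), symmetric]
      P_REHSS_inverse(2)
    by (rule left_mult_one_mat[OF c(5)])
qed

text \<open>With $L$ the eliminator, $P$ the preconditioner and $R$ the remainder, an eigenvector $z$
  satisfies $L R z = \lambda L P z$. The lower block row of this equation involves only the
  component $y$ and is the pencil. The upper block row shows that $y = 0$ would leave
  $\lambda A x = 0$; this is where $\lambda \neq 0$ is essential, since every $(x, 0)$ is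
  annihilated by the iteration matrix.\<close>

lemma Gamma_REHSS_eigenvalue_pencil:
  assumes ev: "eigenvalue (cmat (Gamma_REHSS n m A B \<alpha>)) l" and l: "l \<noteq> 0"
  obtains y where "y \<in> carrier_vec m" "y \<noteq> 0\<^sub>v m"
    "cmat (schur_R m A B \<alpha>) *\<^sub>v y = l \<cdot>\<^sub>v (cmat (schur_P m B \<alpha>) *\<^sub>v y)"
proof -
  let ?P = "P_REHSS m A B \<alpha>" and ?R = "R_REHSS n m A B \<alpha>" and ?L = "eliminator n m A B"
  let ?\<Gamma> = "Gamma_REHSS n m A B \<alpha>" and ?S = "schur_P m B \<alpha>" and ?T = "schur_R m A B \<alpha>"
  note c = block_carriers
  note \<Gamma> = Gamma_REHSS
  have LP: "?L * ?P \<in> carrier_mat (n + m) (n + m)" by (rule mult_carrier_mat[OF c(3,4)])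
  obtain z where z: "z \<in> carrier_vec (n + m)" "z \<noteq> 0\<^sub>v (n + m)"
    and \<Gamma>z: "cmat ?\<Gamma> *\<^sub>v z = l \<cdot>\<^sub>v z"
    using ev \<Gamma>(1) by (auto simp: eigenvalue_def eigenvector_def)
  have "cmat (?L * ?R) = cmat (?L * ?P) * cmat ?\<Gamma>"
    unfolding \<Gamma>(2)[symmetric] assoc_mult_mat[OF c(3,4) \<Gamma>(1), symmetric]
    by (rule cmat_mult[OF LP \<Gamma>(1)])
  then have "cmat (?L * ?R) *\<^sub>v z = cmat (?L * ?P) *\<^sub>v (cmat ?\<Gamma> *\<^sub>v z)"
    using assoc_mult_mat_vec[of "cmat (?L * ?P)" "n + m" "n + m" "cmat ?\<Gamma>" "n + m" z] LP \<Gamma>(1) z(1)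
    by simp
  also have "\<dots> = l \<cdot>\<^sub>v (cmat (?L * ?P) *\<^sub>v z)"
    unfolding \<Gamma>z by (rule mult_mat_vec[OF _ z(1)]) (use LP in simp)
  finally have LR: "cmat (?L * ?R) *\<^sub>v z = l \<cdot>\<^sub>v (cmat (?L * ?P) *\<^sub>v z)" .
  define x y where "x = vec_first z n" and "y = vec_last z m"
  have z_eq: "z = x @\<^sub>v y" and x: "x \<in> carrier_vec n" and y: "y \<in> carrier_vec m"
    using z by (simp_all add: x_def y_def)
  define N M where "N = (A - 1\<^sub>m n) * transpose_mat B" and "M = A * transpose_mat B"
  have N: "N \<in> carrier_mat n m" unfolding N_def
    using B by (intro mult_carrier_mat[of _ n n] minus_carrier_mat) auto
  have M: "M \<in> carrier_mat n m" unfolding M_def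
    using A_carrier B by (intro mult_carrier_mat[of _ n n]) auto
  have cA: "cmat A \<in> carrier_mat n n" and cN: "cmat N \<in> carrier_mat n m"
    and cM: "cmat M \<in> carrier_mat n m" and cS: "cmat ?S \<in> carrier_mat m m"
    and cT: "cmat ?T \<in> carrier_mat m m" and c0: "cmat (0\<^sub>m n n) = 0\<^sub>m n n" "cmat (0\<^sub>m m n) = 0\<^sub>m m n"
    using A_carrier N M c by auto
  have R': "cmat (?L * ?R) *\<^sub>v z = (cmat N *\<^sub>v y) @\<^sub>v (cmat ?T *\<^sub>v y)"
    unfolding eliminator_times_R z_eq N_def[symmetric]
      cmat_four_block[OF zero_carrier_mat N zero_carrier_mat c(2)] c0
      four_block_mat_mult_vec[OF zero_carrier_mat cN zero_carrier_mat cT x y]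
      zero_mat_mult_vec[OF x]
    using cN cT y by simp
  have P': "cmat (?L * ?P) *\<^sub>v z = (cmat A *\<^sub>v x + cmat M *\<^sub>v y) @\<^sub>v (cmat ?S *\<^sub>v y)"
    unfolding eliminator_times_P z_eq M_def[symmetric]
      cmat_four_block[OF A_carrier M zero_carrier_mat c(1)] c0
      four_block_mat_mult_vec[OF cA cM zero_carrier_mat cS x y]
      zero_mat_mult_vec[OF x]
    using cS y by simp
  have "(cmat N *\<^sub>v y) @\<^sub>v (cmat ?T *\<^sub>v y)
      = (l \<cdot>\<^sub>v (cmat A *\<^sub>v x + cmat M *\<^sub>v y)) @\<^sub>v (l \<cdot>\<^sub>v (cmat ?S *\<^sub>v y))"
    unfolding R'[symmetric] LR P' by (rule eq_vecI) auto
  moreover have "cmat N *\<^sub>v y \<in> carrier_vec n"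
    and "l \<cdot>\<^sub>v (cmat A *\<^sub>v x + cmat M *\<^sub>v y) \<in> carrier_vec n"
    using cN cA cM x y by simp_all
  ultimately have top: "cmat N *\<^sub>v y = l \<cdot>\<^sub>v (cmat A *\<^sub>v x + cmat M *\<^sub>v y)"
    and pencil: "cmat ?T *\<^sub>v y = l \<cdot>\<^sub>v (cmat ?S *\<^sub>v y)"
    using append_vec_eq by blast+
  have "y \<noteq> 0\<^sub>v m"
  proof
    assume y0: "y = 0\<^sub>v m"
    have Ax: "cmat A *\<^sub>v x \<in> carrier_vec n" using cA x by simp
    have "l \<cdot>\<^sub>v (cmat A *\<^sub>v x) = 0\<^sub>v n"
      using top Ax unfolding y0 mult_mat_zero_vec[OF cN] mult_mat_zero_vec[OF cM] by simp
    then have "inverse l \<cdot>\<^sub>v (l \<cdot>\<^sub>v (cmat A *\<^sub>v x)) = 0\<^sub>v n"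
      by (auto intro!: eq_vecI)
    then have 0: "cmat A *\<^sub>v x = 0\<^sub>v n" using l by (simp add: smult_smult_assoc)
    have "x = cmat (mat_inv A * A) *\<^sub>v x"
      unfolding Ai(2) of_real_hom.mat_hom_one using x by simp
    also have "\<dots> = cmat (mat_inv A) *\<^sub>v (cmat A *\<^sub>v x)"
      unfolding cmat_mult[OF Ai_carrier A_carrier]
      by (rule assoc_mult_mat_vec[OF _ cA x]) (use Ai_carrier in simp)
    also have "\<dots> = 0\<^sub>v n"
      unfolding 0 by (rule mult_mat_zero_vec) (use Ai_carrier in simp)
    finally have "x = 0\<^sub>v n" .
    then have "z = 0\<^sub>v (n + m)" unfolding z_eq y0 by (intro eq_vecI) auto
    with z(2) show False by simp
  qed
  with that y pencil show thesis by blast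
qed

text \<open>With $w = B^T x$, the difference of the two forms is $w^T A^{-1} w > 0$ and their sum
  is $2 (\alpha x^T x - x^T Q x) > 0$.\<close>

lemma schur_R_dominated:
  assumes rank: "vec_space.rank m B = m" and \<alpha>_gt: "\<alpha> > lambda_max (Q_REHSS n A B)"
    and x: "x \<in> carrier_vec m" "x \<noteq> 0\<^sub>v m"
  shows "\<bar>x \<bullet> (schur_R m A B \<alpha> *\<^sub>v x)\<bar> < x \<bullet> (schur_P m B \<alpha> *\<^sub>v x)"
proof -
  define w where "w = transpose_mat B *\<^sub>v x"
  have w: "w \<in> carrier_vec n" using B x by (simp add: w_def)
  have "w \<noteq> 0\<^sub>v n"
    using transpose_inj_of_full_row_rank[OF B rank x(1)] x(2) by (auto simp: w_def)
  then have "w \<bullet> (mat_inv A *\<^sub>v w) > 0"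
    using Ai(3) w by (auto simp: sym_pos_def_def)
  moreover have "x \<bullet> (Q_REHSS n A B *\<^sub>v x) \<le> lambda_max (Q_REHSS n A B) * (x \<bullet> x)"
  proof (rule rayleigh_le[OF symmetric_Q_REHSS _ x(1)])
    fix k assume "eigenvalue (Q_REHSS n A B) k"
    then show "k \<le> lambda_max (Q_REHSS n A B)"
      unfolding lambda_max_def using card_finite_spectrum(1)[OF symmetric_Q_REHSS(1)]
      by (intro Max_ge) (auto simp: spectrum_def)
  qed
  moreover have "lambda_max (Q_REHSS n A B) * (x \<bullet> x) < \<alpha> * (x \<bullet> x)"
    using \<alpha>_gt scalar_prod_self_pos[OF x] by (intro mult_strict_right_mono)
  ultimately show ?thesis
    using schur_R_form[OF x(1)] schur_P_form[OF x(1)] Q_REHSS_form[OF x(1)]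
    by (simp flip: w_def)
qed

end

theorem theorem1:
  fixes n m :: nat and A B :: "real mat" and \<alpha> \<delta> :: real
  assumes A: "sym_pos_def n A"
    and B: "B \<in> carrier_mat m n"
    and rank_B: "vec_space.rank m B = m"
    and m_less_n: "m < n"
    and \<delta>: "\<delta> = lambda_max (Q_REHSS n A B)"
    and \<alpha>: "\<alpha> > max \<delta> 0"
  shows "real_spectral_radius (Gamma_REHSS n m A B \<alpha>) < 1"
proof -
  have \<alpha>0: "\<alpha> > 0" and \<alpha>_gt: "\<alpha> > lambda_max (Q_REHSS n A B)"
    using \<alpha> \<delta> by auto
  note ABa = A B \<alpha>0
  let ?\<Gamma> = "cmat (Gamma_REHSS n m A B \<alpha>)"
  have "?\<Gamma> \<in> carrier_mat (n + m) (n + m)"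
    using Gamma_REHSS(1)[OF ABa] by simp
  then obtain l where ev: "eigenvalue ?\<Gamma> l" and \<rho>: "spectral_radius ?\<Gamma> = cmod l"
    using spectral_radius_mem_max(1)[of ?\<Gamma> "n + m"] m_less_n by (auto simp: spectrum_def)
  have "cmod l < 1"
  proof (cases "l = 0")
    case False
    obtain y where y: "y \<in> carrier_vec m" "y \<noteq> 0\<^sub>v m"
      "cmat (schur_R m A B \<alpha>) *\<^sub>v y = l \<cdot>\<^sub>v (cmat (schur_P m B \<alpha>) *\<^sub>v y)"
      using Gamma_REHSS_eigenvalue_pencil[OF ABa ev False] by blast
    show ?thesis
      by (rule symmetric_pencil_norm_less_1[OF block_carriers(2)[OF ABa] transpose_schur_R[OF ABa]
            sym_pos_def_schur_P[OF ABa] schur_R_dominated[OF ABa rank_B \<alpha>_gt] y])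
  qed simp
  then show ?thesis unfolding real_spectral_radius_def \<rho> .
qed

end
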